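(* Let $\mathcal{M}:\mathcal{X}^N\to\mathbb{R}$ be a randomised mechanism and $\sim$ a neighbouring relation such that, for every $X\sim Y$, the outputs $\mathcal{M}(X),\mathcal{M}(Y)$ have everywhere positive densities $f_X,f_Y$ and the privacy loss function $\mathcal{L}_{X/Y}=\log(f_X/f_Y)$ is a continuously differentiable bijection from $\mathbb{R}$ onto $\mathcal{L}_{X/Y}(\mathbb{R})$ with differentiable inverse. Let $\omega_{X/Y}$ be the density of the privacy loss distribution of $\mathcal{M}(X)$ over $\mathcal{M}(Y)$. Let $k\ge 1$ and $\varepsilon>0$. Then the composition of $k$ consecutive applications of $\mathcal{M}$ is tightly $(\varepsilon,\delta)$-DP with respect to $\sim$ for $\delta=\delta(\varepsilon)$ given by $$\delta(\varepsilon)=\sup_{X\sim Y}\max\{\delta_{X/Y}(\varepsilon),\delta_{Y/X}(\varepsilon)\},$$ where $$\delta_{X/Y}(\varepsilon)=\int_\varepsilon^\infty (1-e^{\varepsilon-s})\,(\omega_{X/Y}*^k\omega_{X/Y})(s)\,ds,$$ and $\delta_{Y/X}(\varepsilon)$ is given by the same formula with $\omega_{Y/X}$ in place of $\omega_{X/Y}$.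
   Context: A neighbouring relation $\sim$ is a symmetric relation on datasets. A randomised mechanism $\mathcal{M}$ assigns to each dataset $X$ a random output $\mathcal{M}(X)$ in a measurable space $\mathcal{R}$. It is $(\varepsilon,\delta)$-DP with respect to $\sim$ ($\delta\in[0,1]$) if for all $X\sim Y$ and all measurable $E\subset\mathcal{R}$, $\Pr(\mathcal{M}(X)\in E)\le e^{\varepsilon}\Pr(\mathcal{M}(Y)\in E)+\delta$. It is tightly $(\varepsilon,\delta)$-DP if in addition there is no $\delta'<\delta$ such that it is $(\varepsilon,\delta')$-DP. (A supremum over the empty set is taken to be $0$.) Privacy loss distribution (PLD): for densities $f_X,f_Y$ as in the claim, the PLD of $\mathcal{M}(X)$ over $\mathcal{M}(Y)$ is the random variable with density $$\omega_{X/Y}(s)=f_X\big(\mathcal{L}_{X/Y}^{-1}(s)\big)\,\left|\frac{d\mathcal{L}_{X/Y}^{-1}(s)}{ds}\right|\ \text{ if } s\in\mathcal{L}_{X/Y}(\mathbb{R}),\qquad \omega_{X/Y}(s)=0 \text{ otherwise.}$$ The composition of $k$ consecutive applications of $\mathcal{M}$ is the mechanism with values in $\mathbb{R}^k$ that on input $X$ outputs $k$ independent copies of $\mathcal{M}(X)$; its output density is $\prod_{i=1}^k f_X(t_i)$. The notation $\omega*^k\omega$ denotes the $k$-fold convolution, i.e. the convolution $\omega*\cdots*\omega$ of $k$ copies of $\omega$ (so for $k=1$ it is $\omega$). *)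

theory Defs
  imports "HOL-Probability.Probability"
begin

text \<open>A mechanism is represented by the map sending a dataset to the law of its output.\<close>

definition randomised_mechanism :: "'r measure \<Rightarrow> ('d \<Rightarrow> 'r measure) \<Rightarrow> bool" where
  "randomised_mechanism R M \<longleftrightarrow> (\<forall>X. M X \<in> space (prob_algebra R))"

text \<open>Probabilities and \<open>\<delta>\<close> are taken in \<^typ>\<open>ennreal\<close>, so that \<open>\<delta> \<in> [0,1]\<close> reads
  \<open>\<delta> \<le> 1\<close>, integrals of nonnegative functions and suprema need no side conditions, and the
  supremum of the empty set is \<open>0\<close>.\<close>

definition dp ::
  "('d \<Rightarrow> 'd \<Rightarrow> bool) \<Rightarrow> 'r measure \<Rightarrow> ('d \<Rightarrow> 'r measure) \<Rightarrow> real \<Rightarrow> ennreal \<Rightarrow> bool" where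
  "dp sim R M \<epsilon> \<delta> \<longleftrightarrow> \<delta> \<le> 1 \<and>
     (\<forall>X Y. sim X Y \<longrightarrow>
       (\<forall>E\<in>sets R. emeasure (M X) E \<le> ennreal (exp \<epsilon>) * emeasure (M Y) E + \<delta>))"

definition tightly_dp ::
  "('d \<Rightarrow> 'd \<Rightarrow> bool) \<Rightarrow> 'r measure \<Rightarrow> ('d \<Rightarrow> 'r measure) \<Rightarrow> real \<Rightarrow> ennreal \<Rightarrow> bool" where
  "tightly_dp sim R M \<epsilon> \<delta> \<longleftrightarrow> dp sim R M \<epsilon> \<delta> \<and> \<not> (\<exists>\<delta>'<\<delta>. dp sim R M \<epsilon> \<delta>')"

text \<open>The product measure is the law of \<open>k\<close> independent copies; its points are the functions
  on \<open>{..<k}\<close>, i.e. the \<open>k\<close>-tuples.\<close>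

definition composition :: "nat \<Rightarrow> ('d \<Rightarrow> 'r measure) \<Rightarrow> 'd \<Rightarrow> (nat \<Rightarrow> 'r) measure" where
  "composition k M X = (\<Pi>\<^sub>M i\<in>{..<k}. M X)"

definition has_positive_density :: "real measure \<Rightarrow> (real \<Rightarrow> real) \<Rightarrow> bool" where
  "has_positive_density P f \<longleftrightarrow>
     f \<in> borel_measurable borel \<and> (\<forall>t. 0 < f t) \<and> P = density lborel (\<lambda>t. ennreal (f t))"

definition privacy_loss :: "(real \<Rightarrow> real) \<Rightarrow> (real \<Rightarrow> real) \<Rightarrow> real \<Rightarrow> real" where
  "privacy_loss f g t = ln (f t / g t)"

text \<open>For a \<open>C\<^sup>1\<close> injection \<open>L\<close> on the line the range is open, so \<^const>\<open>deriv\<close> of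
  \<^term>\<open>inv L\<close> at a point of the range does not see the values of \<^term>\<open>inv L\<close> off the range.\<close>

definition pld_density :: "(real \<Rightarrow> real) \<Rightarrow> (real \<Rightarrow> real) \<Rightarrow> real \<Rightarrow> real" where
  "pld_density f g s =
     (let L = privacy_loss f g
      in if s \<in> range L then f (inv L s) * \<bar>deriv (inv L) s\<bar> else 0)"

definition conv :: "(real \<Rightarrow> ennreal) \<Rightarrow> (real \<Rightarrow> ennreal) \<Rightarrow> real \<Rightarrow> ennreal" where
  "conv u v s = (\<integral>\<^sup>+ t. u t * v (s - t) \<partial>lborel)"

text \<open>Convolution of \<open>k\<close> copies, for \<open>k \<ge> 1\<close>; the value at \<open>k = 0\<close> is irrelevant.\<close>

definition conv_power :: "nat \<Rightarrow> (real \<Rightarrow> ennreal) \<Rightarrow> real \<Rightarrow> ennreal" where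
  "conv_power k u = (conv u ^^ (k - 1)) u"

text \<open>On the domain of integration \<^term>\<open>1 - exp (\<epsilon> - s)\<close> is positive, so \<^const>\<open>ennreal\<close>
  does not truncate it.\<close>

definition delta_pair :: "nat \<Rightarrow> (real \<Rightarrow> real) \<Rightarrow> (real \<Rightarrow> real) \<Rightarrow> real \<Rightarrow> ennreal" where
  "delta_pair k f g \<epsilon> =
     (\<integral>\<^sup>+ s\<in>{\<epsilon><..}. ennreal (1 - exp (\<epsilon> - s)) *
        conv_power k (\<lambda>u. ennreal (pld_density f g u)) s \<partial>lborel)"

end

theory Submission imports Defs begin

text \<open>Write \<open>S x = (\<Sum>i<k. L (x i))\<close> for the total privacy loss. Then \<open>Q\<^sup>k\<close> has density \<open>exp (- S)\<close>
  with respect to \<open>P\<^sup>k\<close>, so \<open>P\<^sup>k E - exp \<epsilon> * Q\<^sup>k E\<close> is the \<open>P\<^sup>k\<close>-integral of \<open>1 - exp (\<epsilon> - S)\<close>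
  over \<open>E\<close>. It is largest for \<open>E = {x. \<epsilon> < S x}\<close>, which yields tightness. By change of variables \<open>L\<close> has
  density \<open>\<omega>\<close> under \<open>P\<close>, hence \<open>S\<close> has density \<open>\<omega> *\<^sup>k \<omega>\<close> under \<open>P\<^sup>k\<close>, and the maximum is
  \<open>\<delta>\<^bsub>X/Y\<^esub>(\<epsilon>)\<close>.\<close>

section \<open>Convolution powers, sums of independent losses, and densities of product
  measures\<close>

lemma measurable_conv [measurable]:
  assumes [measurable]: "u \<in> borel_measurable borel" "v \<in> borel_measurable borel"
  shows "conv u v \<in> borel_measurable borel"
  unfolding conv_def by measurable

lemma measurable_conv_funpow [measurable]:
  assumes [measurable]: "u \<in> borel_measurable borel"
  shows "(conv u ^^ k) u \<in> borel_measurable borel"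
  by (induction k) auto

text \<open>Tonelli followed by the translation of \<open>s\<close> by \<open>t\<close>. Testing
  against an arbitrary \<open>h\<close> makes the convolution act as the law of a sum, which is the
  form needed in the induction over the number of copies below.\<close>

lemma nn_integral_conv:
  assumes [measurable]: "u \<in> borel_measurable borel" "v \<in> borel_measurable borel"
    "h \<in> borel_measurable borel"
  shows "(\<integral>\<^sup>+ s. conv u v s * h s \<partial>lborel) = (\<integral>\<^sup>+ t. u t * (\<integral>\<^sup>+ s. v s * h (t + s) \<partial>lborel) \<partial>lborel)"
proof -
  have "(\<integral>\<^sup>+ s. conv u v s * h s \<partial>lborel)
      = (\<integral>\<^sup>+ s. (\<integral>\<^sup>+ t. u t * v (s - t) * h s \<partial>lborel) \<partial>lborel)"
    unfolding conv_def by (simp add: nn_integral_multc)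
  also have "\<dots> = (\<integral>\<^sup>+ t. (\<integral>\<^sup>+ s. u t * v (s - t) * h s \<partial>lborel) \<partial>lborel)"
    by (rule lborel_pair.Fubini') measurable
  also have "\<dots> = (\<integral>\<^sup>+ t. u t * (\<integral>\<^sup>+ s. v (s - t) * h s \<partial>lborel) \<partial>lborel)"
    by (simp add: nn_integral_cmult mult.assoc)
  also have "\<dots> = (\<integral>\<^sup>+ t. u t * (\<integral>\<^sup>+ s. v s * h (t + s) \<partial>lborel) \<partial>lborel)"
  proof (rule nn_integral_cong)
    fix t
    have "(\<integral>\<^sup>+ s. v (s - t) * h s \<partial>lborel) = (\<integral>\<^sup>+ s. v s * h (t + s) \<partial>lborel)"
      by (subst nn_integral_real_affine[where c = 1 and t = t]) auto
    then show "u t * (\<integral>\<^sup>+ s. v (s - t) * h s \<partial>lborel) = u t * (\<integral>\<^sup>+ s. v s * h (t + s) \<partial>lborel)"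
      by simp
  qed
  finally show ?thesis .
qed

text \<open>Induction on the number of copies, splitting off the last coordinate by Tonelli.
  \<open>Suc k\<close> copies go with \<open>k\<close> applications of \<open>conv w\<close> to
  \<open>w\<close>, so the induction starts at one copy, where the claim is just the law of
  \<open>L\<close>.\<close>

lemma nn_integral_PiM_sum:
  assumes "prob_space P" and [measurable]: "L \<in> borel_measurable P" "w \<in> borel_measurable borel"
    and distr: "distr P borel L = density lborel w"
    and [measurable]: "h \<in> borel_measurable borel"
  shows "(\<integral>\<^sup>+ x. h (\<Sum>i<Suc k. L (x i)) \<partial>(\<Pi>\<^sub>M i\<in>{..<Suc k}. P))
    = (\<integral>\<^sup>+ s. (conv w ^^ k) w s * h s \<partial>lborel)"
proof -
  interpret P: prob_space P by fact
  interpret product_sigma_finite "\<lambda>_::nat. P" ..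
  have single: "(\<integral>\<^sup>+ t. h (L t) \<partial>P) = (\<integral>\<^sup>+ s. w s * h s \<partial>lborel)"
    if [measurable]: "h \<in> borel_measurable borel" for h
  proof -
    have "(\<integral>\<^sup>+ t. h (L t) \<partial>P) = (\<integral>\<^sup>+ s. h s \<partial>distr P borel L)"
      by (rule nn_integral_distr[symmetric]) measurable
    then show ?thesis
      by (simp add: distr nn_integral_density)
  qed
  show ?thesis
    \<comment> \<open>\<open>h\<close> has to vary in the induction: the hypothesis is applied to
      the translates of \<open>h\<close> by \<open>L y\<close>, where \<open>y\<close> is the
      coordinate split off.\<close>
    using \<open>h \<in> borel_measurable borel\<close>
  proof (induction k arbitrary: h)
    case 0
    then have [measurable]: "h \<in> borel_measurable borel" .
    have "(\<integral>\<^sup>+ x. h (L (x 0)) \<partial>(\<Pi>\<^sub>M i\<in>{0::nat}. P)) = (\<integral>\<^sup>+ t. h (L t) \<partial>P)"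
      by (rule product_nn_integral_singleton) measurable
    then show ?case
      by (simp add: single lessThan_Suc)
  next
    case (Suc k)
    then have [measurable]: "h \<in> borel_measurable borel" by simp
    have "(\<integral>\<^sup>+ x. h (\<Sum>i<Suc (Suc k). L (x i)) \<partial>(\<Pi>\<^sub>M i\<in>insert (Suc k) {..<Suc k}. P))
        = (\<integral>\<^sup>+ y. (\<integral>\<^sup>+ x. h (\<Sum>i<Suc (Suc k). L ((x(Suc k := y)) i)) \<partial>(\<Pi>\<^sub>M i\<in>{..<Suc k}. P)) \<partial>P)"
    \<comment> \<open>The new coordinate is integrated outermost, so that its density
      \<open>w\<close> ends up as the left factor of the convolution, as in
      \<open>conv w ^^ Suc k\<close>.\<close>
    proof (rule product_nn_integral_insert_rev)
      show "(\<lambda>x. h (\<Sum>i<Suc (Suc k). L (x i))) \<in> borel_measurable (\<Pi>\<^sub>M i\<in>insert (Suc k) {..<Suc k}. P)"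
      proof (rule measurable_compose[OF borel_measurable_sum])
        fix i assume "i \<in> {..<Suc (Suc k)}"
        then have "(\<lambda>x. x i) \<in> (\<Pi>\<^sub>M i\<in>insert (Suc k) {..<Suc k}. P) \<rightarrow>\<^sub>M P"
          by (intro measurable_component_singleton) auto
        then show "(\<lambda>x. L (x i)) \<in> borel_measurable (\<Pi>\<^sub>M i\<in>insert (Suc k) {..<Suc k}. P)"
          by measurable
      qed measurable
    qed auto
    also have "\<dots> = (\<integral>\<^sup>+ y. (\<integral>\<^sup>+ x. h (L y + (\<Sum>i<Suc k. L (x i))) \<partial>(\<Pi>\<^sub>M i\<in>{..<Suc k}. P)) \<partial>P)"
      by (simp add: add.commute)
    also have "\<dots> = (\<integral>\<^sup>+ y. (\<integral>\<^sup>+ s. (conv w ^^ k) w s * h (L y + s) \<partial>lborel) \<partial>P)"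
      by (intro nn_integral_cong Suc.IH) measurable
    also have "\<dots> = (\<integral>\<^sup>+ t. w t * (\<integral>\<^sup>+ s. (conv w ^^ k) w s * h (t + s) \<partial>lborel) \<partial>lborel)"
      by (rule single) measurable
    also have "\<dots> = (\<integral>\<^sup>+ s. (conv w ^^ Suc k) w s * h s \<partial>lborel)"
      by (simp add: nn_integral_conv)
    finally show ?case
      by (simp only: lessThan_Suc)
  qed
qed

text \<open>A product of sigma-finite measures over a finite index set is determined by its values
  on boxes. On a box the integrand is a product of functions of single coordinates, so its integral
  factors.\<close>

lemma PiM_density:
  fixes r :: "'a \<Rightarrow> ennreal"
  assumes "prob_space P" "prob_space (density P r)" "finite I"
    and [measurable]: "r \<in> borel_measurable P"
  shows "(\<Pi>\<^sub>M i\<in>I. density P r) = density (\<Pi>\<^sub>M i\<in>I. P) (\<lambda>x. \<Prod>i\<in>I. r (x i))"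
proof -
  interpret P: prob_space P by fact
  interpret Q: prob_space "density P r" by fact
  interpret P: product_sigma_finite "\<lambda>_. P" ..
  interpret Q: product_sigma_finite "\<lambda>_. density P r" ..
  have [measurable]: "(\<lambda>x. \<Prod>i\<in>I. r (x i)) \<in> borel_measurable (\<Pi>\<^sub>M i\<in>I. P)"
    by measurable
  show ?thesis
  proof (rule Q.PiM_eqI[symmetric])
    show "sets (density (\<Pi>\<^sub>M i\<in>I. P) (\<lambda>x. \<Prod>i\<in>I. r (x i))) = sets (\<Pi>\<^sub>M i\<in>I. density P r)"
      by (simp cong: sets_PiM_cong)
    fix A :: "'b \<Rightarrow> 'a set" assume "\<And>i. i \<in> I \<Longrightarrow> A i \<in> sets (density P r)"
    then have A: "\<And>i. i \<in> I \<Longrightarrow> A i \<in> sets P" by simp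
    have "emeasure (density (\<Pi>\<^sub>M i\<in>I. P) (\<lambda>x. \<Prod>i\<in>I. r (x i))) (Pi\<^sub>E I A)
        = (\<integral>\<^sup>+ x. (\<Prod>i\<in>I. r (x i)) * indicator (Pi\<^sub>E I A) x \<partial>(\<Pi>\<^sub>M i\<in>I. P))"
      using A \<open>finite I\<close> by (intro emeasure_density sets_PiM_I_finite) auto
    also have "\<dots> = (\<integral>\<^sup>+ x. (\<Prod>i\<in>I. r (x i) * indicator (A i) (x i)) \<partial>(\<Pi>\<^sub>M i\<in>I. P))"
      using \<open>finite I\<close>
      \<comment> \<open>Points of the product space are extensional, so membership in the box is
        just membership in each \<open>A i\<close>, and the indicator of the box is the product of
        the indicators.\<close>
      by (intro nn_integral_cong)
        (auto simp: prod.distrib indicator_def space_PiM PiE_iff prod_zero_iff split: if_splits)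
    also have "\<dots> = (\<Prod>i\<in>I. \<integral>\<^sup>+ t. r t * indicator (A i) t \<partial>P)"
      using A \<open>finite I\<close> by (intro P.product_nn_integral_prod) auto
    also have "\<dots> = (\<Prod>i\<in>I. emeasure (density P r) (A i))"
      using A by (intro prod.cong refl) (simp add: emeasure_density)
    finally show "emeasure (density (\<Pi>\<^sub>M i\<in>I. P) (\<lambda>x. \<Prod>i\<in>I. r (x i))) (Pi\<^sub>E I A)
        = (\<Prod>i\<in>I. emeasure (density P r) (A i))" .
  qed fact
qed

section \<open>Change of variables: the law of the privacy loss\<close>

text \<open>A continuous injection of the line is an open map, so differentiability of the inverse
  within \<open>range L\<close> is differentiability in the full sense. The indicators put 0 in
  place of the arbitrary values off the range, which gives globally defined Borel functions.\<close>

lemma C1_injection_inverse: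
  fixes L :: "real \<Rightarrow> real"
  assumes C1: "L C1_differentiable_on UNIV" and inj: "inj L"
    and diff: "inv L differentiable_on range L"
  shows "open (range L)"
    and "s \<in> range L \<Longrightarrow> (inv L has_field_derivative deriv (inv L) s) (at s)"
    and "(\<lambda>s. indicator (range L) s * inv L s) \<in> borel_measurable borel"
    and "(\<lambda>s. indicator (range L) s * deriv (inv L) s) \<in> borel_measurable borel"
proof -
  have L: "(L has_field_derivative deriv L t) (at t)" for t
    using C1 by (auto simp: C1_differentiable_on_eq differentiable_def
        has_vector_derivative_def[symmetric] DERIV_deriv_iff_real_differentiable)
  have contL: "continuous_on UNIV L"
    using L by (meson DERIV_isCont continuous_at_imp_continuous_on)
  have "deriv L t = vector_derivative L (at t)" for t
    using L by (metis has_real_derivative_iff_has_vector_derivative vector_derivative_at)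
  then have "continuous_on UNIV (deriv L)"
    using C1 by (simp add: C1_differentiable_on_eq)
  then have [measurable]: "deriv L \<in> borel_measurable borel"
    by (rule borel_measurable_continuous_onI)
  show opn: "open (range L)"
    using injective_into_1d_imp_open_map_UNIV[of UNIV UNIV L] contL inj by auto
  then have [measurable]: "range L \<in> sets borel"
    by simp
  show D: "(inv L has_field_derivative deriv (inv L) s) (at s)" if "s \<in> range L" for s
    using diff that opn
    by (metis differentiable_on_eq_differentiable_at DERIV_deriv_iff_real_differentiable)
  have "continuous_on (range L) (inv L)"
    using diff by (rule differentiable_imp_continuous_on)
  then show [measurable]: "(\<lambda>s. indicator (range L) s * inv L s) \<in> borel_measurable borel"
    using borel_measurable_continuous_on_indicator[of "range L" "inv L"] by simp
  \<comment> \<open>The inverse is only assumed differentiable, so its derivative is not known to be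
    continuous. Differentiating \<open>L (inv L s) = s\<close> expresses it through the continuous
    \<open>deriv L\<close>, and measurability follows.\<close>
  have "deriv (inv L) s = inverse (deriv L (inv L s))" if "s \<in> range L" for s
  proof -
    have "((\<lambda>t. L (inv L t)) has_field_derivative deriv L (inv L s) * deriv (inv L) s) (at s)"
      by (rule DERIV_chain2[OF L D[OF that]])
    moreover have "((\<lambda>t. L (inv L t)) has_field_derivative 1) (at s)"
      by (rule has_field_derivative_transform_within_open[OF DERIV_ident opn that])
        (simp add: f_inv_into_f)
    ultimately have "deriv L (inv L s) * deriv (inv L) s = 1"
      by (rule DERIV_unique)
    then show ?thesis
      by (metis inverse_unique)
  qed
  then have "(\<lambda>s. indicator (range L) s * deriv (inv L) s)
      = (\<lambda>s. indicator (range L) s * inverse (deriv L (indicator (range L) s * inv L s)))"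
    by (auto simp: fun_eq_iff indicator_def)
  also have "\<dots> \<in> borel_measurable borel"
    by measurable
  finally show "(\<lambda>s. indicator (range L) s * deriv (inv L) s) \<in> borel_measurable borel" .
qed

text \<open>The mass that the law of \<open>L\<close> gives to \<open>A\<close> is the integral of
  \<open>f\<close> over the preimage of \<open>A\<close>. Substituting \<open>t = inv L s\<close>
  turns it into the integral of the PLD density over \<open>A\<close>.\<close>

lemma
  fixes f g :: "real \<Rightarrow> real"
  defines "L \<equiv> privacy_loss f g"
  assumes fin: "finite_measure (density lborel (\<lambda>t. ennreal (f t)))"
    and [measurable]: "f \<in> borel_measurable borel" and nonneg: "\<And>t. 0 \<le> f t"
    and C1: "L C1_differentiable_on UNIV" and inj: "inj L"
    and diff: "inv L differentiable_on range L"
  shows measurable_pld_density: "pld_density f g \<in> borel_measurable borel"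
    and distr_privacy_loss: "distr (density lborel (\<lambda>t. ennreal (f t))) borel L
      = density lborel (\<lambda>s. ennreal (pld_density f g s))"
proof -
  note inverse = C1_injection_inverse[OF C1 inj diff]
  note [measurable] = inverse(3,4)
  have "continuous_on UNIV L"
    using C1 by (auto simp: C1_differentiable_on_eq intro!: continuous_at_imp_continuous_on
        differentiable_imp_continuous_within)
  then have [measurable]: "L \<in> borel_measurable borel"
    by (rule borel_measurable_continuous_onI)
  have [measurable]: "range L \<in> sets borel"
    using inverse(1) by simp
  have "pld_density f g = (\<lambda>s. indicator (range L) s
      * (f (indicator (range L) s * inv L s) * \<bar>indicator (range L) s * deriv (inv L) s\<bar>))"
    by (auto simp: fun_eq_iff pld_density_def L_def Let_def indicator_def)
  also have "\<dots> \<in> borel_measurable borel"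
    by measurable
  finally show [measurable]: "pld_density f g \<in> borel_measurable borel" .
  show "distr (density lborel (\<lambda>t. ennreal (f t))) borel L
      = density lborel (\<lambda>s. ennreal (pld_density f g s))"
  proof (rule measure_eqI)
    fix A assume "A \<in> sets (distr (density lborel (\<lambda>t. ennreal (f t))) borel L)"
    then have [measurable]: "A \<in> sets borel" by simp
    define \<phi> where "\<phi> t = f t * indicator A (L t)" for t
    have [measurable]: "\<phi> \<in> borel_measurable borel"
      unfolding \<phi>_def by measurable
    have \<phi>: "0 \<le> \<phi> t" for t
      using nonneg by (simp add: \<phi>_def)
    let ?P = "density lborel (\<lambda>t. ennreal (f t))"
    have *: "emeasure (distr ?P borel L) A = (\<integral>\<^sup>+ t. ennreal (\<phi> t) \<partial>lborel)"
    proof -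
      have "emeasure (distr ?P borel L) A = emeasure ?P (L -` A)"
        by (simp add: emeasure_distr)
      also have "\<dots> = (\<integral>\<^sup>+ t. ennreal (f t) * indicator (L -` A) t \<partial>lborel)"
        using measurable_sets_borel[OF \<open>L \<in> _\<close> \<open>A \<in> sets borel\<close>]
        by (intro emeasure_density) auto
      also have "\<dots> = (\<integral>\<^sup>+ t. ennreal (\<phi> t) \<partial>lborel)"
        by (auto intro!: nn_integral_cong simp: \<phi>_def indicator_def)
      finally show ?thesis .
    qed
    \<comment> \<open>The substitution rule is about absolutely integrable real functions, so the
      nonnegative integral must first be identified with a finite real \<open>b\<close>. This is
      where \<open>fin\<close> enters.\<close>
    moreover have "emeasure (distr ?P borel L) A < \<infinity>"
      using finite_measure.emeasure_finite[OF fin]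
      by (simp add: emeasure_distr top.not_eq_extremum)
    ultimately obtain b where b: "0 \<le> b" "(\<integral>\<^sup>+ t. ennreal (\<phi> t) \<partial>lborel) = ennreal b"
      by (cases "\<integral>\<^sup>+ t. ennreal (\<phi> t) \<partial>lborel") auto
    have "(\<phi> has_integral b) UNIV"
      by (rule nn_integral_has_integral) (use \<phi> b in auto)
    then have "\<phi> absolutely_integrable_on inv L ` range L \<and> integral (inv L ` range L) \<phi> = b"
      using \<phi> inj by (auto simp: image_image absolutely_integrable_on_iff_nonneg
          has_integral_integrable_integral)
    then have "(\<lambda>s. \<bar>deriv (inv L) s\<bar> * \<phi> (inv L s)) absolutely_integrable_on range L
        \<and> integral (range L) (\<lambda>s. \<bar>deriv (inv L) s\<bar> * \<phi> (inv L s)) = b"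
      by (subst has_absolute_integral_change_of_variables_1')
        (auto intro: inverse(2) has_field_derivative_at_within inj_on_inv_into)
    then have "((\<lambda>s. \<bar>deriv (inv L) s\<bar> * \<phi> (inv L s)) has_integral b) (range L)"
      by (auto simp: has_integral_integrable_integral set_lebesgue_integral_eq_integral)
    then have "ennreal b
        = (\<integral>\<^sup>+ s. ennreal (\<bar>deriv (inv L) s\<bar> * \<phi> (inv L s)) * indicator (range L) s \<partial>lborel)"
      using \<phi> by (intro nn_integral_has_integral_lebesgue'[symmetric]) auto
    also have "\<dots> = (\<integral>\<^sup>+ s. ennreal (pld_density f g s) * indicator A s \<partial>lborel)"
      \<comment> \<open>On the range \<open>L (inv L s) = s\<close>, so the factor
        \<open>indicator A (L t)\<close> hidden in \<open>\<phi>\<close> becomes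
        \<open>indicator A s\<close>.\<close>
      by (intro nn_integral_cong)
        (auto simp: pld_density_def L_def[symmetric] \<phi>_def Let_def indicator_def f_inv_into_f mult.commute)
    finally show "emeasure (distr ?P borel L) A
        = emeasure (density lborel (\<lambda>s. ennreal (pld_density f g s))) A"
      by (simp add: * b emeasure_density)
  qed simp
qed

section \<open>The optimal event and its excess probability\<close>

text \<open>With \<open>a = \<epsilon> - S x\<close>, split \<open>1 = exp a + (1 - exp a)\<close>
  where \<open>a < 0\<close>, that is on the set \<open>\<epsilon> < S x\<close>. Integrating the
  two summands gives \<open>exp \<epsilon>\<close> times the \<open>Q\<close>-mass and
  \<open>D\<close>. Additive statements avoid truncated subtraction in
  \<open>ennreal\<close>.\<close>

lemma
  fixes \<epsilon> :: real
  assumes [measurable]: "S \<in> borel_measurable P" "E \<in> sets P"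
    and Q: "Q = density P (\<lambda>x. ennreal (exp (- S x)))"
  defines "D \<equiv> (\<integral>\<^sup>+ x. ennreal (1 - exp (\<epsilon> - S x)) * indicator {\<epsilon><..} (S x) \<partial>P)"
  shows emeasure_le_hockey_stick: "emeasure P E \<le> ennreal (exp \<epsilon>) * emeasure Q E + D"
    and emeasure_eq_hockey_stick: "emeasure P {x\<in>space P. \<epsilon> < S x}
      = ennreal (exp \<epsilon>) * emeasure Q {x\<in>space P. \<epsilon> < S x} + D"
proof -
  have eQ: "ennreal (exp \<epsilon>) * emeasure Q A = (\<integral>\<^sup>+ x. ennreal (exp (\<epsilon> - S x)) * indicator A x \<partial>P)"
    if [measurable]: "A \<in> sets P" for A
    by (simp add: Q emeasure_density nn_integral_cmult[symmetric] mult.assoc[symmetric]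
        ennreal_mult[symmetric] exp_add[symmetric])
  have split: "ennreal (exp a) + ennreal (1 - exp a) = 1" if "a < 0" for a :: real
    using that by (simp add: ennreal_plus[symmetric] del: ennreal_plus)
  have "emeasure P E = (\<integral>\<^sup>+ x. indicator E x \<partial>P)"
    by simp
  also have "\<dots> \<le> (\<integral>\<^sup>+ x. ennreal (exp (\<epsilon> - S x)) * indicator E x
      + ennreal (1 - exp (\<epsilon> - S x)) * indicator {\<epsilon><..} (S x) \<partial>P)"
    \<comment> \<open>Where \<open>\<epsilon> < S x\<close>, the split applies on \<open>E\<close>
      and the bound is trivial off it. Where \<open>S x \<le> \<epsilon>\<close>, the second summand
      vanishes, but on \<open>E\<close> the first is already at least 1.\<close>
    using split[of "\<epsilon> - S _"] by (intro nn_integral_mono) (auto simp: indicator_def)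
  also have "\<dots> = ennreal (exp \<epsilon>) * emeasure Q E + D"
    unfolding D_def by (simp add: eQ nn_integral_add)
  finally show "emeasure P E \<le> ennreal (exp \<epsilon>) * emeasure Q E + D" .
  let ?A = "{x\<in>space P. \<epsilon> < S x}"
  have "emeasure P ?A = (\<integral>\<^sup>+ x. indicator ?A x \<partial>P)"
    by simp
  also have "\<dots> = (\<integral>\<^sup>+ x. ennreal (exp (\<epsilon> - S x)) * indicator ?A x
      + ennreal (1 - exp (\<epsilon> - S x)) * indicator {\<epsilon><..} (S x) \<partial>P)"
    using split[of "\<epsilon> - S _"] by (intro nn_integral_cong) (auto simp: indicator_def)
  also have "\<dots> = ennreal (exp \<epsilon>) * emeasure Q ?A + D"
    unfolding D_def by (simp add: eQ nn_integral_add)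
  finally show "emeasure P ?A = ennreal (exp \<epsilon>) * emeasure Q ?A + D" .
qed

text \<open>The hockey-stick statements are applied to the product measures, with the total loss
  \<open>S\<close> as log-likelihood ratio. What remains is to recognise \<open>D\<close> as
  \<open>delta_pair\<close>.\<close>

lemma
  fixes f g :: "real \<Rightarrow> real"
  assumes "prob_space P" "prob_space Q"
    and "has_positive_density P f" "has_positive_density Q g"
    and C1: "privacy_loss f g C1_differentiable_on UNIV" and inj: "inj (privacy_loss f g)"
    and diff: "inv (privacy_loss f g) differentiable_on range (privacy_loss f g)"
    and "k \<ge> 1"
  shows emeasure_le_delta_pair: "E \<in> sets (\<Pi>\<^sub>M i\<in>{..<k}. borel) \<Longrightarrow>
      emeasure (\<Pi>\<^sub>M i\<in>{..<k}. P) E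
        \<le> ennreal (exp \<epsilon>) * emeasure (\<Pi>\<^sub>M i\<in>{..<k}. Q) E + delta_pair k f g \<epsilon>"
    and emeasure_eq_delta_pair: "\<exists>A\<in>sets (\<Pi>\<^sub>M i\<in>{..<k}. borel). emeasure (\<Pi>\<^sub>M i\<in>{..<k}. P) A
        = ennreal (exp \<epsilon>) * emeasure (\<Pi>\<^sub>M i\<in>{..<k}. Q) A + delta_pair k f g \<epsilon>"
proof -
  define L where "L = privacy_loss f g"
  define S where "S x = (\<Sum>i<k. L (x i))" for x :: "nat \<Rightarrow> real"
  let ?Pk = "\<Pi>\<^sub>M i\<in>{..<k}. P" and ?Qk = "\<Pi>\<^sub>M i\<in>{..<k}. Q"
  interpret P: prob_space P by fact
  have [measurable]: "f \<in> borel_measurable borel" "g \<in> borel_measurable borel"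
    and pos: "0 < f t" "0 < g t" and P: "P = density lborel (\<lambda>t. ennreal (f t))"
    and Q: "Q = density lborel (\<lambda>t. ennreal (g t))" for t
    using assms(3,4) by (auto simp: has_positive_density_def)
  have sets_P: "sets P = sets borel"
    by (simp add: P)
  have sets_Pk: "sets ?Pk = sets (\<Pi>\<^sub>M i\<in>{..<k}. borel)"
    by (intro sets_PiM_cong refl) (simp add: sets_P)
  have [measurable]: "L \<in> borel_measurable borel"
    unfolding L_def privacy_loss_def by measurable
  then have LP [measurable]: "L \<in> borel_measurable P"
    by (simp add: measurable_cong_sets[OF sets_P refl])
  have [simp]: "f t \<noteq> 0" "g t \<noteq> 0" for t
    using pos[of t] by auto
  \<comment> \<open>The likelihood ratio \<open>g t / f t\<close> is \<open>exp (- L t)\<close> by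
    the definition of the loss and positivity of both densities.\<close>
  have QP: "Q = density P (\<lambda>t. ennreal (exp (- L t)))"
    using pos unfolding P Q
    by (subst density_density_eq)
      (auto simp: L_def privacy_loss_def ennreal_mult[symmetric] exp_minus less_imp_le
        intro!: density_cong)
  have "?Qk = density ?Pk (\<lambda>x. \<Prod>i<k. ennreal (exp (- L (x i))))"
    unfolding QP by (rule PiM_density) (use assms(1,2) QP in auto)
  then have Qk: "?Qk = density ?Pk (\<lambda>x. ennreal (exp (- S x)))"
    by (simp add: S_def prod_ennreal exp_sum sum_negf[symmetric])
  have S [measurable]: "S \<in> borel_measurable ?Pk"
    unfolding S_def by measurable
  have "delta_pair k f g \<epsilon>
      = (\<integral>\<^sup>+ s. (conv (pld_density f g) ^^ (k - 1)) (pld_density f g) s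
          * (ennreal (1 - exp (\<epsilon> - s)) * indicator {\<epsilon><..} s) \<partial>lborel)"
    by (simp add: delta_pair_def conv_power_def mult_ac)
  also have "\<dots> = (\<integral>\<^sup>+ x. ennreal (1 - exp (\<epsilon> - S x)) * indicator {\<epsilon><..} (S x) \<partial>?Pk)"
  proof -
    have "finite_measure (density lborel (\<lambda>t. ennreal (f t)))"
      using P.finite_measure_axioms P by simp
    then have "pld_density f g \<in> borel_measurable borel"
      "distr P borel L = density lborel (\<lambda>s. ennreal (pld_density f g s))"
      using pos C1 inj diff unfolding P L_def
      by (auto intro!: measurable_pld_density distr_privacy_loss less_imp_le)
    \<comment> \<open>\<open>k - 1\<close> is the number of convolutions in
      \<open>conv_power k\<close>, and \<open>Suc (k - 1) = k\<close> because
      \<open>k \<ge> 1\<close>.\<close>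
    then show ?thesis
      using nn_integral_PiM_sum[of P L "\<lambda>s. ennreal (pld_density f g s)"
          "\<lambda>s. ennreal (1 - exp (\<epsilon> - s)) * indicator {\<epsilon><..} s" "k - 1"] \<open>k \<ge> 1\<close> \<open>prob_space P\<close>
      by (simp add: S_def)
  qed
  finally have delta: "delta_pair k f g \<epsilon>
      = (\<integral>\<^sup>+ x. ennreal (1 - exp (\<epsilon> - S x)) * indicator {\<epsilon><..} (S x) \<partial>?Pk)" .
  show "emeasure ?Pk E \<le> ennreal (exp \<epsilon>) * emeasure ?Qk E + delta_pair k f g \<epsilon>"
    if "E \<in> sets (\<Pi>\<^sub>M i\<in>{..<k}. borel)"
    unfolding delta by (rule emeasure_le_hockey_stick[OF S _ Qk]) (simp add: sets_Pk that)
  have "{x\<in>space ?Pk. \<epsilon> < S x} \<in> sets (\<Pi>\<^sub>M i\<in>{..<k}. borel)"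
    unfolding sets_Pk[symmetric] by measurable
  then show "\<exists>A\<in>sets (\<Pi>\<^sub>M i\<in>{..<k}. borel). emeasure ?Pk A
      = ennreal (exp \<epsilon>) * emeasure ?Qk A + delta_pair k f g \<epsilon>"
    unfolding delta using emeasure_eq_hockey_stick[OF S sets.top Qk] by blast
qed

theorem theorem6:
  fixes M :: "'x ^ ('n::finite) \<Rightarrow> real measure"
    and sim :: "'x ^ 'n \<Rightarrow> 'x ^ 'n \<Rightarrow> bool"
    and f :: "'x ^ 'n \<Rightarrow> real \<Rightarrow> real"
    and k :: nat and \<epsilon> :: real
  assumes "randomised_mechanism borel M"
    and "symp sim"
    and "\<And>X Y. sim X Y \<Longrightarrow> has_positive_density (M X) (f X) \<and> has_positive_density (M Y) (f Y)"
    and "\<And>X Y. sim X Y \<Longrightarrow> privacy_loss (f X) (f Y) C1_differentiable_on UNIV"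
    and "\<And>X Y. sim X Y \<Longrightarrow>
           bij_betw (privacy_loss (f X) (f Y)) UNIV (range (privacy_loss (f X) (f Y)))"
    and "\<And>X Y. sim X Y \<Longrightarrow>
           inv (privacy_loss (f X) (f Y)) differentiable_on range (privacy_loss (f X) (f Y))"
    and "k \<ge> 1"
    and "\<epsilon> > 0"
  shows "tightly_dp sim (\<Pi>\<^sub>M i\<in>{..<k}. borel) (composition k M) \<epsilon>
           (SUP (X, Y)\<in>{(X, Y). sim X Y}.
              max (delta_pair k (f X) (f Y) \<epsilon>) (delta_pair k (f Y) (f X) \<epsilon>))"
proof -
  let ?R = "\<Pi>\<^sub>M i\<in>{..<k}. (borel :: real measure)"
  let ?\<delta> = "SUP (X, Y)\<in>{(X, Y). sim X Y}.
      max (delta_pair k (f X) (f Y) \<epsilon>) (delta_pair k (f Y) (f X) \<epsilon>)"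
  have prob: "prob_space (M X)" for X
    using assms(1) by (auto simp: randomised_mechanism_def space_prob_algebra)
  then have prob_comp: "prob_space (composition k M X)" for X
    unfolding composition_def by (intro prob_space_PiM)
  have inj: "inj (privacy_loss (f X) (f Y))" if "sim X Y" for X Y
    using assms(5)[OF that] by (rule bij_betw_imp_inj_on)
  have upper: "emeasure (composition k M X) E
      \<le> ennreal (exp \<epsilon>) * emeasure (composition k M Y) E + delta_pair k (f X) (f Y) \<epsilon>"
    if "sim X Y" "E \<in> sets ?R" for X Y E
    unfolding composition_def
    by (rule emeasure_le_delta_pair) (use that assms prob inj in blast)+
  have attained: "\<exists>A\<in>sets ?R. emeasure (composition k M X) A
      = ennreal (exp \<epsilon>) * emeasure (composition k M Y) A + delta_pair k (f X) (f Y) \<epsilon>"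
    if "sim X Y" for X Y
    unfolding composition_def
    by (rule emeasure_eq_delta_pair) (use that assms prob inj in blast)+
  \<comment> \<open>Evaluate the bound at the event attaining equality and cancel the common term,
    which is finite since \<open>composition k M Y\<close> is a probability measure. This is used
    twice: with \<open>1\<close>, and with any competing privacy parameter.\<close>
  have delta_le: "delta_pair k (f X) (f Y) \<epsilon> \<le> \<delta>'"
    if "sim X Y" and le: "\<And>E. E \<in> sets ?R \<Longrightarrow> emeasure (composition k M X) E
      \<le> ennreal (exp \<epsilon>) * emeasure (composition k M Y) E + \<delta>'" for X Y \<delta>'
  proof -
    interpret prob_space "composition k M Y" by (rule prob_comp)
    obtain A where "A \<in> sets ?R" "emeasure (composition k M X) A
        = ennreal (exp \<epsilon>) * emeasure (composition k M Y) A + delta_pair k (f X) (f Y) \<epsilon>"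
      using attained[OF \<open>sim X Y\<close>] by blast
    with le[of A] show ?thesis
      by (simp add: ennreal_add_left_cancel_le ennreal_mult_eq_top_iff)
  qed
  \<comment> \<open>Both entries of the maximum are covered by one hypothesis, since symmetry of
    \<open>sim\<close> supplies the reversed pair.\<close>
  have Sup_le: "?\<delta> \<le> \<delta>'"
    if "\<And>X Y. sim X Y \<Longrightarrow> delta_pair k (f X) (f Y) \<epsilon> \<le> \<delta>'" for \<delta>'
    using that assms(2) by (auto intro!: SUP_least dest: sympD)
  \<comment> \<open>The value \<open>1\<close> always satisfies the premise of
    \<open>delta_le\<close>, because probabilities are at most 1.\<close>
  have "?\<delta> \<le> 1"
    by (intro Sup_le delta_le)
      (auto intro: order_trans[OF prob_space.emeasure_le_1[OF prob_comp]] simp: add_increasing)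
  moreover have "delta_pair k (f X) (f Y) \<epsilon> \<le> ?\<delta>" if "sim X Y" for X Y
    using that by (intro SUP_upper2[where i = "(X, Y)"]) auto
  then have "emeasure (composition k M X) E
      \<le> ennreal (exp \<epsilon>) * emeasure (composition k M Y) E + ?\<delta>"
    if "sim X Y" "E \<in> sets ?R" for X Y E
    using upper[OF that] that(1) by (meson add_left_mono order_trans)
  moreover have "?\<delta> \<le> \<delta>'" if "dp sim ?R (composition k M) \<epsilon> \<delta>'" for \<delta>'
    using that by (intro Sup_le delta_le) (auto simp: dp_def)
  \<comment> \<open>The supremum lies below every admissible \<open>\<delta>'\<close>, so no
    admissible value can be strictly smaller.\<close>
  ultimately show ?thesis
    unfolding tightly_dp_def dp_def by (meson leD)
qed

end
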